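(* Let $K$ be an uncountable compact metric space with at most finitely many isolated points and let $d\in \mathbb{N}^+$. Then for a prevalent $f\in C(K,\mathbb{R}^d)$ we have \[ \underline{\dim}_B\operatorname{graph}(f)=\underline{\dim}_B K+d \quad\text{and}\quad \overline{\dim}_B \operatorname{graph}(f)=\overline{\dim}_B K+d. \]
   Context: $C(K,\mathbb{R}^d)$ is the Banach space of continuous maps $K\to\mathbb{R}^d$ with the maximum (supremum) norm, regarded as an abelian Polish group under addition. A set $A\subset G$ in an abelian Polish group $G$ is shy (Haar null) if there exist a Borel set $B\supset A$ and a Borel probability measure $\mu$ on $G$ with $\mu(B+x)=0$ for all $x\in G$; a set is prevalent if its complement is shy; "for a prevalent $f$ property P holds" means the set of $f$ with property P contains a prevalent set. For a metric space $(X,\rho)$, $X\times\mathbb{R}^d$ carries the metric $\sqrt{\rho(x_1,x_2)^2+|z_1-z_2|^2}$, and $\operatorname{graph}(f)=\{(x,f(x)):x\in K\}\subset K\times\mathbb{R}^d$. A set $S$ is a $\delta$-packing if $\rho(x,z)>\delta$ for all distinct $x,z\in S$; $N_n(X)$ is the maximal cardinality of a $2^{-n}$-packing in $X$. For non-empty totally bounded $X$, $\underline{\dim}_B X=\liminf_{n} \frac{\log N_n(X)}{n\log 2}$ and $\overline{\dim}_B X=\limsup_n \frac{\log N_n(X)}{n\log 2}$. *)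

theory Defs
  imports "HOL-Analysis.Analysis" "HOL-Probability.Probability"
begin

definition packing :: "real \<Rightarrow> 'a::metric_space set \<Rightarrow> bool" where
  "packing \<delta> S \<longleftrightarrow> (\<forall>x\<in>S. \<forall>z\<in>S. x \<noteq> z \<longrightarrow> dist x z > \<delta>)"

definition packing_number :: "nat \<Rightarrow> 'a::metric_space set \<Rightarrow> nat" where
  "packing_number n X = Sup {card S | S. S \<subseteq> X \<and> finite S \<and> packing (2 powr - real n) S}"

definition lower_box_dim :: "'a::metric_space set \<Rightarrow> ereal" where
  "lower_box_dim X = liminf (\<lambda>n. ereal (ln (real (packing_number n X)) / (real n * ln 2)))"

definition upper_box_dim :: "'a::metric_space set \<Rightarrow> ereal" where
  "upper_box_dim X = limsup (\<lambda>n. ereal (ln (real (packing_number n X)) / (real n * ln 2)))"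

definition shy :: "'g::{topological_space, ab_group_add} set \<Rightarrow> bool" where
  "shy A \<longleftrightarrow> (\<exists>B \<mu>. B \<in> sets borel \<and> A \<subseteq> B \<and> prob_space \<mu> \<and> sets \<mu> = sets borel \<and>
      (\<forall>x. emeasure \<mu> ((\<lambda>b. b + x) ` B) = 0))"

definition prevalent :: "'g::{topological_space, ab_group_add} set \<Rightarrow> bool" where
  "prevalent A \<longleftrightarrow> shy (- A)"

definition prevalently :: "('g::{topological_space, ab_group_add} \<Rightarrow> bool) \<Rightarrow> bool" where
  "prevalently P \<longleftrightarrow> (\<exists>S. prevalent S \<and> S \<subseteq> {f. P f})"

definition graph :: "('a \<Rightarrow> 'b) \<Rightarrow> ('a \<times> 'b) set" where
  "graph f = (\<lambda>x. (x, f x)) ` UNIV"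

end

(* For every f, a cell of side about 2^-n in the target is a set of diameter at most 2^-n, so
   N_n(graph f) <= N_(n+2)(K) (C 2^n)^d, which gives the upper bounds.

   For the lower bounds the measure witnessing shyness is the law of F = sum_n (n+1)^-2 I_n, where
   I_n interpolates independent uniform values in the unit cube at about N_n(K) 2^(nd) / (n+1)^(2d+2)
   nodes of K, grouped into clusters around a 2^-n-packing by non-isolated points. Conditionally on
   all other values, g + F at a node is uniform on a cube of side (n+1)^-2, while its value at any
   other node of level n is fixed. So a pair of nodes in a common cluster has graph points at
   distance at most 2^-n with probability at most (2 (n+1)^2 2^-n)^d. By Markov's inequality and
   Borel-Cantelli, almost surely for all large n at least half of the nodes of level n give a
   2^-n-packing of the graph of g + F. *)
theory Submission
  imports Defs "HOL-Real_Asymp.Real_Asymp"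
begin

section \<open>Packings in compact metric spaces\<close>

text \<open>Upper bounds on packings come from this: a packing is at most as large as the label set
  of any labelling under which equal labels force distance at most \<open>\<delta>\<close>.\<close>

lemma packing_inj_on:
  assumes "packing \<delta> S" and "\<And>x y. x \<in> S \<Longrightarrow> y \<in> S \<Longrightarrow> h x = h y \<Longrightarrow> dist x y \<le> \<delta>"
  shows "inj_on h S"
  using assms unfolding packing_def inj_on_def by (meson not_le)

text \<open>Label each point by the centre of a ball of radius \<open>\<delta> / 2\<close>
  containing it, the balls coming from a finite subcover; the triangle inequality keeps points with
  equal labels within \<open>\<delta>\<close>.\<close>

lemma compact_packing_bounded:
  fixes X :: "'a::metric_space set"
  assumes "compact X" "\<delta> > 0"
  obtains B where "\<And>S. S \<subseteq> X \<Longrightarrow> packing \<delta> S \<Longrightarrow> finite S \<and> card S \<le> B"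
proof -
  obtain C where C: "finite C" "C \<subseteq> X" "X \<subseteq> (\<Union>x\<in>C. ball x (\<delta> / 2))"
    using compactE_image[OF assms(1), of X "\<lambda>x. ball x (\<delta> / 2)"] assms(2) by force
  have "finite S \<and> card S \<le> card C" if S: "S \<subseteq> X" "packing \<delta> S" for S
  proof -
    have "\<forall>x\<in>S. \<exists>c\<in>C. dist c x < \<delta> / 2"
      using C(3) S(1) by fastforce
    then obtain h where h: "\<And>x. x \<in> S \<Longrightarrow> h x \<in> C \<and> dist (h x) x < \<delta> / 2"
      by metis
    have "inj_on h S"
    proof (rule packing_inj_on[OF S(2)])
      fix x y assume "x \<in> S" "y \<in> S" "h x = h y"
      then show "dist x y \<le> \<delta>"
        using h[of x] h[of y] dist_triangle_half_r[of "h x" x \<delta> y] by simp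
    qed
    moreover have "h ` S \<subseteq> C"
      using h by auto
    ultimately show ?thesis
      using C(1) by (metis card_inj_on_le finite_imageD finite_subset)
  qed
  then show thesis using that by blast
qed

text \<open>These two facts make the \<open>Sup\<close> on \<open>nat\<close> in
  \<open>packing_number\<close> an attained maximum rather than a default value.\<close>

lemma compact_packing_cards:
  fixes X :: "'a::metric_space set" and n :: nat
  assumes "compact X"
  defines "P \<equiv> {card S | S. S \<subseteq> X \<and> finite S \<and> packing (2 powr - real n) S}"
  shows "finite P" "P \<noteq> {}"
proof -
  obtain B where "\<And>S. S \<subseteq> X \<Longrightarrow> packing (2 powr - real n) S \<Longrightarrow> finite S \<and> card S \<le> B"
    using compact_packing_bounded[OF assms(1), of "2 powr - real n"] by auto
  then have "P \<subseteq> {..B}"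
    unfolding P_def by auto
  then show "finite P" by (rule finite_subset) simp
  have "card {} \<in> P"
    unfolding P_def by (rule CollectI, rule exI[of _ "{}"]) (simp add: packing_def)
  then show "P \<noteq> {}" by auto
qed

lemma packing_card_le_packing_number:
  assumes "compact X" "S \<subseteq> X" "finite S" "packing (2 powr - real n) S"
  shows "card S \<le> packing_number n X"
  unfolding packing_number_def
  using compact_packing_cards(1)[OF assms(1), of n] assms
  by (intro cSup_upper bdd_above_finite) blast+

lemma packing_number_attained:
  assumes "compact X"
  obtains S where "S \<subseteq> X" "finite S" "packing (2 powr - real n) S" "card S = packing_number n X"
proof -
  let ?P = "{card S | S. S \<subseteq> X \<and> finite S \<and> packing (2 powr - real n) S}"
  have "Sup ?P \<in> ?P"
    using compact_packing_cards[OF assms, of n] by (simp add: cSup_eq_Max del: mem_Collect_eq)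
  then show thesis
    using that unfolding packing_number_def by (smt (verit) mem_Collect_eq)
qed

lemma packing_number_pos:
  assumes "compact X" "X \<noteq> {}"
  shows "packing_number n X > 0"
proof -
  obtain x where "x \<in> X" using assms(2) by auto
  then have "card {x} \<le> packing_number n X"
    by (intro packing_card_le_packing_number assms) (auto simp: packing_def)
  then show ?thesis by simp
qed

text \<open>A point violating this could be added to \<open>S\<close>, giving a packing larger than
  the maximal one.\<close>

lemma maximal_packing_net:
  assumes "compact X" "S \<subseteq> X" "finite S" "packing (2 powr - real n) S"
    and card: "card S = packing_number n X" and "x \<in> X"
  shows "\<exists>s\<in>S. dist x s \<le> 2 powr - real n"
proof (rule ccontr)
  assume "\<not> ?thesis"
  then have far: "\<And>s. s \<in> S \<Longrightarrow> dist x s > 2 powr - real n"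
    by force
  then have "x \<notin> S"
    by fastforce
  moreover have "card (insert x S) \<le> packing_number n X"
    using assms far by (intro packing_card_le_packing_number) (auto simp: packing_def dist_commute)
  ultimately show False
    using card \<open>finite S\<close> by simp
qed

section \<open>Upper bound for packings of a graph\<close>

lemma compact_graph:
  fixes f :: "'a::metric_space \<Rightarrow> 'b::metric_space"
  assumes "compact (UNIV :: 'a set)" "continuous_on UNIV f"
  shows "compact (graph f)"
  unfolding graph_def using assms
  by (intro compact_continuous_image continuous_intros) auto

text \<open>A graph point is labelled by a nearby point of a maximal \<open>2^-(n+2)\<close>-packing
  of the domain and by the grid cell of its value. Equal labels put both coordinates within
  \<open>2^-(n+1)\<close>, hence the points within \<open>2^-n\<close>. The bound on
  \<open>f\<close> leaves \<open>2 * L + 1\<close> cell indices per coordinate.\<close>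

lemma packing_number_graph_le:
  fixes f :: "'a::metric_space \<Rightarrow> 'b::euclidean_space"
  assumes K: "compact (UNIV :: 'a set)" and f: "continuous_on UNIV f"
  shows "\<exists>C>0. \<forall>n. real (packing_number n (graph f))
           \<le> real (packing_number (n + 2) (UNIV :: 'a set)) * (C * 2 ^ n) ^ DIM('b)"
proof -
  have "bounded (range f)"
    using compact_continuous_image[OF f K] by (rule compact_imp_bounded)
  then obtain R where R: "R > 0" "\<And>x. norm (f x) \<le> R"
    unfolding bounded_pos by auto
  define D where "D = real DIM('b)"
  have D: "D \<ge> 1"
    unfolding D_def using DIM_positive[where 'a='b] by linarith
  \<comment> \<open>Chosen so that
    \<open>2 * (R / s) + 3 = 4 * R * D * 2 ^ n + 3 \<le> C * 2 ^ n\<close> for the side length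
    \<open>s\<close> below.\<close>
  define C where "C = 4 * R * D + 3"
  have "real (packing_number n (graph f))
           \<le> real (packing_number (n + 2) (UNIV :: 'a set)) * (C * 2 ^ n) ^ DIM('b)" for n
  proof -
    obtain S where S: "S \<subseteq> graph f" "finite S" "packing (2 powr - real n) S"
        "card S = packing_number n (graph f)"
      using packing_number_attained[OF compact_graph[OF K f]] by blast
    obtain T :: "'a set" where T: "finite T" "packing (2 powr - real (n + 2)) T"
        "card T = packing_number (n + 2) (UNIV :: 'a set)"
      using packing_number_attained[OF K] by blast
    then obtain c where c: "\<And>x. c x \<in> T" "\<And>x. dist x (c x) \<le> 2 powr - real (n + 2)"
      using maximal_packing_net[OF K, of T "n + 2"] by (metis UNIV_I subset_UNIV)
    \<comment> \<open>Coordinate differences of at most \<open>s\<close> sum to at most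
      \<open>D * s = 2^-(n+1)\<close>.\<close>
    define s where "s = 1 / (2 ^ (n + 1) * D)"
    have s: "s > 0" using D by (simp add: s_def)
    define L where "L = \<lfloor>R / s\<rfloor> + 1"
    define cell where "cell = (\<lambda>y. \<lambda>b\<in>Basis. \<lfloor>y \<bullet> (b::'b) / s\<rfloor>)"
    define J where "J = (Basis :: 'b set) \<rightarrow>\<^sub>E {- L..L}"
    have cell_in: "cell (f x) \<in> J" for x
      unfolding cell_def J_def
    proof (rule restrict_PiE_iff[THEN iffD2], rule ballI)
      fix b :: 'b assume b: "b \<in> Basis"
      have "\<bar>f x \<bullet> b\<bar> \<le> R"
        using Basis_le_norm[OF b, of "f x"] R(2)[of x] by linarith
      then have "\<bar>f x \<bullet> b / s\<bar> \<le> R / s"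
        using s by (simp add: divide_right_mono)
      then show "\<lfloor>f x \<bullet> b / s\<rfloor> \<in> {- L..L}"
        unfolding L_def atLeastAtMost_iff by linarith
    qed
    have cell_dist: "dist y z \<le> 2 powr - real (n + 1)" if "cell y = cell z" for y z :: 'b
    proof -
      have "\<bar>(y - z) \<bullet> b\<bar> \<le> s" if b: "b \<in> Basis" for b
      proof -
        have "\<lfloor>y \<bullet> b / s\<rfloor> = \<lfloor>z \<bullet> b / s\<rfloor>"
          using \<open>cell y = cell z\<close> b unfolding cell_def by (metis restrict_apply')
        then have "\<bar>y \<bullet> b / s - z \<bullet> b / s\<bar> < 1"
          by linarith
        then have "\<bar>(y \<bullet> b - z \<bullet> b) / s\<bar> < 1"
          by (simp add: diff_divide_distrib)
        then show ?thesis
          using s by (simp add: inner_diff_left field_simps abs_divide)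
      qed
      then have "norm (y - z) \<le> D * s"
        using norm_le_l1[of "y - z"] sum_bounded_above[of Basis "\<lambda>b. \<bar>(y - z) \<bullet> b\<bar>" s]
        unfolding D_def by fastforce
      also have "D * s = 2 powr - real (n + 1)"
        using D by (subst powr_minus, subst powr_realpow) (simp_all add: s_def field_simps)
      finally show ?thesis by (simp add: dist_norm)
    qed
    define h where "h = (\<lambda>z :: 'a \<times> 'b. (c (fst z), cell (snd z)))"
    have "inj_on h S"
    proof (rule packing_inj_on[OF S(3)])
      fix u v assume "u \<in> S" "v \<in> S" and huv: "h u = h v"
      have "u \<in> graph f" "v \<in> graph f"
        using \<open>u \<in> S\<close> \<open>v \<in> S\<close> S(1) by auto
      then obtain x y where [simp]: "u = (x, f x)" "v = (y, f y)"
        unfolding graph_def by auto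
      have "dist x y \<le> dist x (c x) + dist y (c y)"
        using huv dist_triangle2[of x y "c x"] by (simp add: h_def)
      also have "\<dots> \<le> 2 powr - real (n + 1)"
        using c(2)[of x] c(2)[of y] by (simp add: powr_diff powr_minus[of 2 2])
      finally have xy: "dist x y \<le> 2 powr - real (n + 1)" .
      have "dist (f x) (f y) \<le> 2 powr - real (n + 1)"
        using huv by (intro cell_dist) (simp add: h_def)
      moreover have "dist u v \<le> dist x y + dist (f x) (f y)"
        by (simp add: dist_Pair_Pair sqrt_sum_squares_le_sum)
      moreover have "2 powr - real (n + 1) + 2 powr - real (n + 1) = 2 powr - real n"
        by (simp add: powr_diff powr_minus_divide)
      ultimately show "dist u v \<le> 2 powr - real n"
        using xy by linarith
    qed
    moreover have "h ` S \<subseteq> T \<times> J"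
      using S(1) c(1) cell_in by (auto simp: h_def graph_def)
    moreover have "finite (T \<times> J)"
      using T(1) by (simp add: J_def finite_PiE)
    ultimately have "card S \<le> card (T \<times> J)"
      by (rule card_inj_on_le)
    also have "\<dots> = card T * nat (2 * L + 1) ^ DIM('b)"
      by (simp add: card_cartesian_product J_def card_PiE)
    finally have "real (card S) \<le> real (card T) * real (nat (2 * L + 1)) ^ DIM('b)"
      by (metis of_nat_le_iff of_nat_mult of_nat_power)
    also have "\<dots> \<le> real (card T) * (C * 2 ^ n) ^ DIM('b)"
    proof (intro mult_left_mono power_mono)
      have "L \<ge> 0"
        unfolding L_def using R(1) s by (simp add: add_nonneg_nonneg)
      then have "real (nat (2 * L + 1)) = 2 * real_of_int L + 1"
        by simp
      also have "\<dots> \<le> 2 * (R / s) + 3"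
        unfolding L_def by simp linarith
      also have "\<dots> \<le> C * 2 ^ n"
        using one_le_power[of "2::real" n] by (simp add: s_def C_def algebra_simps)
      finally show "real (nat (2 * L + 1)) \<le> C * 2 ^ n" .
    qed auto
    finally show ?thesis using S(4) T(3) by simp
  qed
  moreover have "C > 0" using R D by (simp add: C_def add_nonneg_pos)
  ultimately show ?thesis by blast
qed

section \<open>From packing bounds to box dimensions\<close>

text \<open>Additive terms converging to \<open>d\<close> and factors converging to 1 pass through
  \<open>liminf\<close> and \<open>limsup\<close>, and a shift of the index by \<open>k\<close>
  changes neither.\<close>

lemma liminf_limsup_eq_add_of_bounds:
  fixes u v :: "nat \<Rightarrow> ereal" and d :: ereal
  assumes d: "\<bar>d\<bar> \<noteq> \<infinity>"
    and lower: "\<alpha> \<longlonglongrightarrow> d" "eventually (\<lambda>n. u n + \<alpha> n \<le> v n) sequentially"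
    and upper: "\<beta> \<longlonglongrightarrow> d" "\<gamma> \<longlonglongrightarrow> 1"
      "eventually (\<lambda>n. v n \<le> \<gamma> n * u (n + k) + \<beta> n) sequentially"
  shows "liminf v = liminf u + d" "limsup v = limsup u + d"
proof -
  have "liminf (\<lambda>n. \<beta> n + \<gamma> n * u (n + k)) = d + 1 * liminf u"
    by (subst ereal_liminf_lim_add[OF upper(1) d], subst ereal_liminf_lim_mult[OF upper(2)])
       (auto simp: liminf_shift_k)
  moreover have "liminf v \<le> liminf (\<lambda>n. \<beta> n + \<gamma> n * u (n + k))"
    by (rule Liminf_mono) (use upper(3) in \<open>simp add: add.commute\<close>)
  moreover have "liminf (\<lambda>n. \<alpha> n + u n) = d + liminf u"
    by (rule ereal_liminf_lim_add[OF lower(1) d])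
  moreover have "liminf (\<lambda>n. \<alpha> n + u n) \<le> liminf v"
    by (rule Liminf_mono) (use lower(2) in \<open>simp add: add.commute\<close>)
  ultimately show "liminf v = liminf u + d"
    by (simp add: add.commute)
  have "limsup (\<lambda>n. \<beta> n + \<gamma> n * u (n + k)) = d + 1 * limsup u"
    by (subst ereal_limsup_lim_add[OF upper(1) d], subst ereal_limsup_lim_mult[OF upper(2)])
       (auto simp: limsup_shift_k)
  moreover have "limsup v \<le> limsup (\<lambda>n. \<beta> n + \<gamma> n * u (n + k))"
    by (rule Limsup_mono) (use upper(3) in \<open>simp add: add.commute\<close>)
  moreover have "limsup (\<lambda>n. \<alpha> n + u n) = d + limsup u"
    by (rule ereal_limsup_lim_add[OF lower(1) d])
  moreover have "limsup (\<lambda>n. \<alpha> n + u n) \<le> limsup v"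
    by (rule Limsup_mono) (use lower(2) in \<open>simp add: add.commute\<close>)
  ultimately show "limsup v = limsup u + d"
    by (simp add: add.commute)
qed

text \<open>Taking logarithms and dividing by \<open>n * ln 2\<close> turns
  \<open>2 ^ (n * d)\<close> into \<open>d\<close>; constants and the polynomial factor contribute
  terms that tend to 0.\<close>

lemma box_dim_eq_add:
  assumes X: "compact X" "X \<noteq> {}" and Y: "compact Y" "Y \<noteq> {}"
    and upper: "C > 0" "\<And>n. real (packing_number n Y) \<le> real (packing_number (n + 2) X) * (C * 2 ^ n) ^ d"
    and lower: "c > 0" "eventually (\<lambda>n. c * real (packing_number n X) * 2 ^ (n * d) / real (n + 1) ^ k
                                 \<le> real (packing_number n Y)) sequentially"
  shows "lower_box_dim Y = lower_box_dim X + ereal (real d)"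
    and "upper_box_dim Y = upper_box_dim X + ereal (real d)"
proof -
  define N where "N = (\<lambda>n. real (packing_number n X))"
  define G where "G = (\<lambda>n. real (packing_number n Y))"
  have N: "N n > 0" for n using packing_number_pos[OF X] by (simp add: N_def)
  have G: "G n > 0" for n using packing_number_pos[OF Y] by (simp add: G_def)
  define u where "u = (\<lambda>n. ln (N n) / (real n * ln 2))"
  define v where "v = (\<lambda>n. ln (G n) / (real n * ln 2))"
  define \<alpha> where "\<alpha> = (\<lambda>n. real d + (ln c - real k * ln (real (n + 1))) / (real n * ln 2))"
  define \<beta> where "\<beta> = (\<lambda>n. real d + real d * ln C / (real n * ln 2))"
  \<comment> \<open>Compensates for the packing number of scale \<open>n + 2\<close> appearing over
    the denominator of scale \<open>n\<close>.\<close>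
  define \<gamma> where "\<gamma> = (\<lambda>n. (real n + 2) / real n)"
  have "\<alpha> \<longlonglongrightarrow> real d" unfolding \<alpha>_def by real_asymp
  then have \<alpha>: "(\<lambda>n. ereal (\<alpha> n)) \<longlonglongrightarrow> ereal (real d)" by simp
  have "\<beta> \<longlonglongrightarrow> real d" unfolding \<beta>_def by real_asymp
  then have \<beta>: "(\<lambda>n. ereal (\<beta> n)) \<longlonglongrightarrow> ereal (real d)" by simp
  have "\<gamma> \<longlonglongrightarrow> 1" unfolding \<gamma>_def by real_asymp
  then have \<gamma>: "(\<lambda>n. ereal (\<gamma> n)) \<longlonglongrightarrow> 1" by (simp add: one_ereal_def)
  have "eventually (\<lambda>n. ereal (u n) + ereal (\<alpha> n) \<le> ereal (v n)) sequentially"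
    using lower(2) eventually_gt_at_top[of 0]
  proof eventually_elim
    case (elim n)
    have "ln (c * N n * 2 ^ (n * d) / real (n + 1) ^ k) \<le> ln (G n)"
      using elim(1) N[of n] \<open>c > 0\<close> G[of n] by (subst ln_le_cancel_iff) (auto simp: N_def G_def)
    also have "ln (c * N n * 2 ^ (n * d) / real (n + 1) ^ k)
        = ln (N n) + real n * real d * ln 2 + (ln c - real k * ln (real (n + 1)))"
      using N[of n] \<open>c > 0\<close> by (simp add: ln_mult ln_div ln_realpow del: of_nat_add of_nat_Suc)
    finally have "(ln (N n) + real n * real d * ln 2 + (ln c - real k * ln (real (n + 1)))) / (real n * ln 2)
        \<le> v n"
      unfolding v_def using elim(2) by (intro divide_right_mono) auto
    moreover have "(ln (N n) + real n * real d * ln 2 + (ln c - real k * ln (real (n + 1)))) / (real n * ln 2)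
        = u n + \<alpha> n"
      unfolding u_def \<alpha>_def using elim(2) by (simp add: add_divide_distrib)
    ultimately show ?case by simp
  qed
  moreover have "eventually (\<lambda>n. ereal (v n) \<le> ereal (\<gamma> n) * ereal (u (n + 2)) + ereal (\<beta> n)) sequentially"
    using eventually_gt_at_top[of 0]
  proof eventually_elim
    case (elim n)
    have "ln (G n) \<le> ln (N (n + 2) * (C * 2 ^ n) ^ d)"
      using upper(2)[of n] N[of "n + 2"] \<open>C > 0\<close> G[of n]
      by (subst ln_le_cancel_iff) (auto simp: N_def G_def)
    also have "\<dots> = ln (N (n + 2)) + (real d * ln C + real d * real n * ln 2)"
      using N[of "n + 2"] \<open>C > 0\<close> by (simp add: ln_mult ln_realpow algebra_simps)
    finally have "v n \<le> (ln (N (n + 2)) + (real d * ln C + real d * real n * ln 2)) / (real n * ln 2)"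
      unfolding v_def using elim by (intro divide_right_mono) auto
    also have "\<dots> = ln (N (n + 2)) / (real n * ln 2) + \<beta> n"
      unfolding \<beta>_def using elim by (simp add: field_simps)
    also have "ln (N (n + 2)) / (real n * ln 2) = \<gamma> n * u (n + 2)"
      unfolding u_def \<gamma>_def of_nat_add using elim by (simp add: divide_simps)
    finally show ?case by simp
  qed
  ultimately have
    "liminf (\<lambda>n. ereal (v n)) = liminf (\<lambda>n. ereal (u n)) + ereal (real d)"
    "limsup (\<lambda>n. ereal (v n)) = limsup (\<lambda>n. ereal (u n)) + ereal (real d)"
    using liminf_limsup_eq_add_of_bounds[OF _ \<alpha> _ \<beta> \<gamma>, of "\<lambda>n. ereal (u n)" "\<lambda>n. ereal (v n)" 2] by auto
  then show "lower_box_dim Y = lower_box_dim X + ereal (real d)"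
    "upper_box_dim Y = upper_box_dim X + ereal (real d)"
    unfolding lower_box_dim_def upper_box_dim_def u_def v_def N_def G_def by auto
qed

section \<open>Interpolation of values at finitely many nodes\<close>

text \<open>The analogue of a Lagrange basis polynomial in a metric space, with distances in place
  of differences.\<close>

definition lagrange :: "'k set \<Rightarrow> ('k \<Rightarrow> 'a::metric_space) \<Rightarrow> 'k \<Rightarrow> 'a \<Rightarrow> real" where
  "lagrange A p k x = (\<Prod>j\<in>A - {k}. dist x (p j) / dist (p k) (p j))"

lemma lagrange_delta:
  assumes "finite A" "inj_on p A" "k \<in> A" "l \<in> A"
  shows "lagrange A p k (p l) = (if l = k then 1 else 0)"
proof (cases "l = k")
  case True
  have "dist (p k) (p j) \<noteq> 0" if "j \<in> A - {k}" for j
    using that assms by (auto simp: inj_on_def)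
  then show ?thesis
    using True by (simp add: lagrange_def)
next
  case False
  then show ?thesis
    using assms unfolding lagrange_def by (auto simp: prod_zero_iff)
qed

lemma continuous_on_lagrange: "continuous_on S (lagrange A p k)"
  unfolding lagrange_def divide_inverse by (intro continuous_intros)

lemma clamp_unit_cube_norm_le: "norm (clamp 0 One x :: 'b::euclidean_space) \<le> real DIM('b)"
proof -
  have "clamp 0 One x \<in> cbox 0 (One :: 'b)"
    by (rule clamp_in_interval) simp
  then have "\<bar>clamp 0 One x \<bullet> b\<bar> \<le> 1" if "b \<in> Basis" for b
    using that unfolding mem_box by fastforce
  then show ?thesis
    using norm_le_l1[of "clamp 0 One x"] sum_bounded_above[of Basis "\<lambda>b. \<bar>clamp 0 One x \<bullet> b\<bar>" 1]
    by fastforce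
qed

text \<open>The clamp keeps all values in the unit cube whatever \<open>w\<close> is, which gives a
  norm bound independent of the nodes. At a node it does not alter a prescribed value that lies in
  the cube.\<close>

definition interp ::
  "'k set \<Rightarrow> ('k \<Rightarrow> 'a::metric_space) \<Rightarrow> ('k \<Rightarrow> 'b::euclidean_space) \<Rightarrow> ('a, 'b) bcontfun"
  where "interp A p w = Bcontfun (\<lambda>x. clamp 0 One (\<Sum>k\<in>A. lagrange A p k x *\<^sub>R w k))"

lemma apply_interp: "apply_bcontfun (interp A p w) x = clamp 0 One (\<Sum>k\<in>A. lagrange A p k x *\<^sub>R w k)"
  for w :: "'k \<Rightarrow> 'b::euclidean_space"
proof -
  have "continuous_on UNIV (\<lambda>y :: 'b. clamp 0 One y)"
    using clamp_continuous_on[of 0 One "\<lambda>y :: 'b. y" UNIV] by simp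
  then have "continuous_on UNIV (\<lambda>x. clamp 0 One (\<Sum>k\<in>A. lagrange A p k x *\<^sub>R w k))"
    by (rule continuous_on_compose2) (auto intro!: continuous_intros continuous_on_lagrange)
  then have "(\<lambda>x. clamp 0 One (\<Sum>k\<in>A. lagrange A p k x *\<^sub>R w k)) \<in> bcontfun"
    by (rule bcontfun_normI) (rule clamp_unit_cube_norm_le)
  then show ?thesis
    unfolding interp_def by (simp add: Bcontfun_inverse)
qed

lemma norm_interp_le: "norm (interp A p w :: ('a::metric_space, 'b::euclidean_space) bcontfun) \<le> real DIM('b)"
  by (rule norm_bound) (simp add: apply_interp clamp_unit_cube_norm_le)

lemma interp_at_node:
  assumes "finite A" "inj_on p A" "k \<in> A"
  shows "apply_bcontfun (interp A p w) (p k) = clamp 0 One (w k)"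
proof -
  have "(\<Sum>j\<in>A. lagrange A p j (p k) *\<^sub>R w j) = (\<Sum>j\<in>A. if j = k then w j else 0)"
    using assms by (intro sum.cong) (auto simp: lagrange_delta)
  then show ?thesis using assms by (simp add: apply_interp)
qed

text \<open>The domain carries the product topology. \<open>clamp\<close> does not increase
  distances and the basis functions are bounded on a compact space, so two interpolants differ by at
  most a finite weighted sum of coordinate distances.\<close>

lemma continuous_on_interp:
  assumes K: "compact (UNIV :: 'a::metric_space set)"
  shows "continuous_on UNIV (\<lambda>w :: 'k::countable \<Rightarrow> 'b::euclidean_space. interp A (p :: 'k \<Rightarrow> 'a) w)"
proof (cases "finite A")
  case True
  have "\<exists>B. \<forall>x. \<bar>lagrange A p k x\<bar> \<le> B" for k
  proof -
    have "bounded (range (lagrange A p k))"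
      using compact_continuous_image[OF continuous_on_lagrange K] by (rule compact_imp_bounded)
    then show ?thesis by (auto simp: bounded_iff)
  qed
  then obtain B where B: "\<And>k x. \<bar>lagrange A p k x\<bar> \<le> B k" by metis
  have "isCont (interp A p) w" for w :: "'k \<Rightarrow> 'b"
  proof -
    have le: "dist (interp A p v) (interp A p w) \<le> (\<Sum>k\<in>A. B k * dist (v k) (w k))" for v
    proof (rule dist_bound)
      fix x
      have "dist (apply_bcontfun (interp A p v) x) (apply_bcontfun (interp A p w) x)
          \<le> norm ((\<Sum>k\<in>A. lagrange A p k x *\<^sub>R v k) - (\<Sum>k\<in>A. lagrange A p k x *\<^sub>R w k))"
        unfolding apply_interp dist_norm[symmetric] by (rule dist_clamps_le_dist_args)
      also have "\<dots> = norm (\<Sum>k\<in>A. lagrange A p k x *\<^sub>R (v k - w k))"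
        by (simp add: sum_subtractf scaleR_diff_right)
      also have "\<dots> \<le> (\<Sum>k\<in>A. B k * dist (v k) (w k))"
        using B by (intro order.trans[OF norm_sum] sum_mono) (simp add: dist_norm mult_right_mono)
      finally show "dist (apply_bcontfun (interp A p v) x) (apply_bcontfun (interp A p w) x)
          \<le> (\<Sum>k\<in>A. B k * dist (v k) (w k))" .
    qed
    have lim: "((\<lambda>v. \<Sum>k\<in>A. B k * dist (v k) (w k)) \<longlongrightarrow> 0) (at w)"
    proof -
      have "continuous_on UNIV (\<lambda>v :: 'k \<Rightarrow> 'b. \<Sum>k\<in>A. B k * dist (v k) (w k))"
        by (intro continuous_intros continuous_on_product_coordinates)
      then have "isCont (\<lambda>v :: 'k \<Rightarrow> 'b. \<Sum>k\<in>A. B k * dist (v k) (w k)) w"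
        by (simp add: continuous_on_eq_continuous_at)
      then show ?thesis by (simp add: isCont_def)
    qed
    have "((\<lambda>v. dist (interp A p v) (interp A p w)) \<longlongrightarrow> 0) (at w)"
    proof (rule Lim_null_comparison[OF always_eventually lim], rule allI)
      show "norm (dist (interp A p v) (interp A p w)) \<le> (\<Sum>k\<in>A. B k * dist (v k) (w k))" for v
        using le[of v] by (simp only: real_norm_def abs_of_nonneg zero_le_dist)
    qed
    then show ?thesis
      unfolding isCont_def by (rule tendsto_dist_iff[THEN iffD2])
  qed
  then show ?thesis by (simp add: continuous_on_eq_continuous_at)
next
  case False
  \<comment> \<open>Sums over an infinite \<open>A\<close> are 0 by convention, so the interpolant
    does not depend on \<open>w\<close>.\<close>
  then have "interp A p = (\<lambda>_ :: 'k \<Rightarrow> 'b. interp A p (\<lambda>_. 0))"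
    by (intro ext bcontfun_eqI) (simp add: apply_interp)
  then show ?thesis
    by (rule ssubst) (rule continuous_on_const)
qed

section \<open>The random series\<close>

text \<open>Summable, so that the series converges uniformly and Borel-Cantelli applies, yet only
  polynomially small, so that small-ball probabilities lose only powers of
  \<open>n + 1\<close>.\<close>

definition amp :: "nat \<Rightarrow> real" where
  "amp n = 1 / real (n + 1) ^ 2"

lemma amp_pos: "amp n > 0"
  by (simp add: amp_def)

lemma summable_amp: "summable amp"
proof -
  have "summable (\<lambda>n. inverse (real (Suc n) ^ 2))"
    using inverse_power_summable[of 2, where 'a=real] by (subst summable_Suc_iff) simp
  then show ?thesis
    unfolding amp_def by (simp add: inverse_eq_divide)
qed

text \<open>Summing the random series by norm comparison requires a Banach space.\<close>

instance bcontfun :: (metric_space, banach) banach ..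

definition random_fun ::
  "(nat \<Rightarrow> 'k set) \<Rightarrow> (nat \<Rightarrow> 'k \<Rightarrow> 'a::metric_space) \<Rightarrow> (nat \<times> 'k \<Rightarrow> 'b::euclidean_space) \<Rightarrow> ('a, 'b) bcontfun"
  where "random_fun A p w = (\<Sum>n. amp n *\<^sub>R interp (A n) (p n) (\<lambda>k. w (n, k)))"

lemma norm_random_fun_term_le:
  "norm (amp n *\<^sub>R interp A p w :: ('a::metric_space, 'b::euclidean_space) bcontfun) \<le> amp n * real DIM('b)"
  using norm_interp_le[of A p w] amp_pos[of n] by (simp add: mult_left_mono)

lemma summable_random_fun:
  "summable (\<lambda>n. amp n *\<^sub>R interp (A n) (p n) (\<lambda>k. w (n, k)) :: ('a::metric_space, 'b::euclidean_space) bcontfun)"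
  using summable_mult2[OF summable_amp, of "real DIM('b)"]
  by (rule summable_comparison_test'[where N = 0]) (rule norm_random_fun_term_le)

text \<open>Weierstrass M-test with bounds independent of \<open>w\<close>. Continuity makes the
  series a Borel measurable function of \<open>w\<close>.\<close>

lemma continuous_on_random_fun:
  assumes K: "compact (UNIV :: 'a::metric_space set)"
  shows "continuous_on UNIV (random_fun A (p :: nat \<Rightarrow> 'k::countable \<Rightarrow> 'a) :: _ \<Rightarrow> ('a, 'b::euclidean_space) bcontfun)"
proof (rule uniform_limit_theorem)
  let ?t = "\<lambda>n (w :: nat \<times> 'k \<Rightarrow> 'b). amp n *\<^sub>R interp (A n) (p n) (\<lambda>k. w (n, k))"
  show "uniform_limit UNIV (\<lambda>n w. \<Sum>i<n. ?t i w) (random_fun A p) sequentially"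
    unfolding random_fun_def
    by (rule Weierstrass_m_test[where M = "\<lambda>n. amp n * real DIM('b)"])
       (rule norm_random_fun_term_le, rule summable_mult2[OF summable_amp])
  have "continuous_on UNIV (\<lambda>(w :: nat \<times> 'k \<Rightarrow> 'b) k. w (n, k))" for n
    by (intro continuous_on_coordinatewise_then_product continuous_on_product_coordinates)
  then have "continuous_on UNIV (?t n)" for n
    by (intro continuous_on_scaleR continuous_on_const
        continuous_on_compose2[OF continuous_on_interp[OF K]]) auto
  then show "\<forall>\<^sub>F n in sequentially. continuous_on UNIV (\<lambda>w. \<Sum>i<n. ?t i w)"
    by (intro always_eventually allI continuous_on_sum) auto
qed simp

lemma bounded_linear_apply_bcontfun:
  "bounded_linear (\<lambda>f :: ('a::topological_space, 'b::real_normed_vector) bcontfun. apply_bcontfun f x)"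
  by (rule bounded_linear_intro[of _ 1]) (simp_all add: norm_bounded)

text \<open>The coordinate \<open>(n, k)\<close> enters only the term of index \<open>n\<close>, so
  the two series differ in a single summand.\<close>

lemma random_fun_upd:
  fixes w :: "nat \<times> 'k \<Rightarrow> 'b::euclidean_space"
  shows "apply_bcontfun (random_fun A p (w((n, k) := u))) x = apply_bcontfun (random_fun A p w) x
    + amp n *\<^sub>R (apply_bcontfun (interp (A n) (p n) (\<lambda>j. (w((n, k) := u)) (n, j))) x
                 - apply_bcontfun (interp (A n) (p n) (\<lambda>j. w (n, j))) x)"
proof -
  let ?t = "\<lambda>w m. amp m *\<^sub>R interp (A m) (p m) (\<lambda>k. w (m, k))"
  have "random_fun A p (w((n, k) := u)) - random_fun A p w = (\<Sum>m. ?t (w((n, k) := u)) m - ?t w m)"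
    unfolding random_fun_def by (rule suminf_diff) (rule summable_random_fun)+
  also have "\<dots> = (\<Sum>m\<in>{n}. ?t (w((n, k) := u)) m - ?t w m)"
    by (rule suminf_finite) auto
  finally have "random_fun A p (w((n, k) := u)) = random_fun A p w + (?t (w((n, k) := u)) n - ?t w n)"
    by (simp add: algebra_simps)
  then show ?thesis by (simp add: scaleR_diff_right)
qed

text \<open>Changing the value at node \<open>k\<close> leaves the function at node \<open>l\<close>
  fixed, while at \<open>k\<close> it depends on \<open>u\<close> through
  \<open>amp n *\<^sub>R u\<close> alone, as the clamp is the identity on the cube.\<close>

lemma random_fun_increment:
  fixes w :: "nat \<times> 'k \<Rightarrow> 'b::euclidean_space"
  assumes "finite (A n)" "inj_on (p n) (A n)" "k \<in> A n" "l \<in> A n" "k \<noteq> l"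
  shows "\<exists>c. \<forall>u\<in>cbox 0 One. apply_bcontfun (g + random_fun A p (w((n, k) := u))) (p n k)
      - apply_bcontfun (g + random_fun A p (w((n, k) := u))) (p n l) = c + amp n *\<^sub>R u"
proof -
  let ?F = "\<lambda>x. apply_bcontfun (g + random_fun A p w) x"
  \<comment> \<open>The constant removes the old contribution of node \<open>k\<close>, clamped
    because \<open>w (n, k)\<close> need not lie in the cube.\<close>
  have "apply_bcontfun (g + random_fun A p (w((n, k) := u))) (p n k)
      - apply_bcontfun (g + random_fun A p (w((n, k) := u))) (p n l)
      = (?F (p n k) - ?F (p n l) - amp n *\<^sub>R clamp 0 One (w (n, k))) + amp n *\<^sub>R u"
    if "u \<in> cbox 0 One" for u
    using that assms by (simp add: random_fun_upd interp_at_node scaleR_diff_right)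
  then show ?thesis by blast
qed

section \<open>Independent uniform values and small-ball estimates\<close>

definition unit_cube_measure :: "'b::euclidean_space measure" where
  "unit_cube_measure = uniform_measure lborel (cbox 0 One)"

lemma emeasure_lborel_unit_cube: "emeasure lborel (cbox 0 One :: 'b::euclidean_space set) = 1"
  by (simp add: emeasure_lborel_cbox_eq)

lemma prob_space_unit_cube_measure: "prob_space unit_cube_measure"
  unfolding unit_cube_measure_def
  by (rule prob_space_uniform_measure) (simp_all add: emeasure_lborel_unit_cube)

lemma sets_unit_cube_measure [simp, measurable_cong]: "sets unit_cube_measure = sets borel"
  by (simp add: unit_cube_measure_def)

definition unit_cube_PiM :: "('i \<Rightarrow> 'b::euclidean_space) measure" where
  "unit_cube_PiM = PiM UNIV (\<lambda>_. unit_cube_measure)"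

lemma prob_space_unit_cube_PiM: "prob_space unit_cube_PiM"
  unfolding unit_cube_PiM_def by (intro prob_space_PiM prob_space_unit_cube_measure)

text \<open>With countably many indices the product sigma-algebra is the Borel one of the product
  topology, so continuity in \<open>w\<close> yields measurability.\<close>

lemma sets_unit_cube_PiM [simp, measurable_cong]:
  "sets (unit_cube_PiM :: ('i::countable \<Rightarrow> 'b::euclidean_space) measure) = sets borel"
  unfolding unit_cube_PiM_def sets_PiM_equal_borel[symmetric] by (intro sets_PiM_cong) auto

lemma space_unit_cube_PiM [simp]: "space (unit_cube_PiM :: ('i::countable \<Rightarrow> 'b::euclidean_space) measure) = UNIV"
  using sets_eq_imp_space_eq[OF sets_unit_cube_PiM] by simp

text \<open>The constraint confines \<open>u\<close> to a ball of radius \<open>\<delta> / a\<close>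
  about the zero \<open>y\<close> of the affine map, and so to a cube of side
  \<open>2 * \<delta> / a\<close>.\<close>

lemma emeasure_unit_cube_affine_le:
  fixes D :: "'b::euclidean_space \<Rightarrow> 'b"
  assumes a: "a > 0" and \<delta>: "\<delta> \<ge> 0" and S: "{u. norm (D u) \<le> \<delta>} \<in> sets borel"
    and D: "\<And>u. u \<in> cbox 0 One \<Longrightarrow> D u = c + a *\<^sub>R u"
  shows "emeasure unit_cube_measure {u. norm (D u) \<le> \<delta>} \<le> ennreal ((2 * \<delta> / a) ^ DIM('b))"
proof -
  define y where "y = - (c /\<^sub>R a)"
  have "emeasure unit_cube_measure {u. norm (D u) \<le> \<delta>}
      = emeasure lborel (cbox 0 One \<inter> {u. norm (D u) \<le> \<delta>})"
    unfolding unit_cube_measure_def using S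
    by (subst emeasure_uniform_measure) (simp_all add: emeasure_lborel_unit_cube divide_ennreal_def)
  also have "\<dots> \<le> emeasure lborel (cbox (y - (\<delta> / a) *\<^sub>R One) (y + (\<delta> / a) *\<^sub>R One))"
  proof (rule emeasure_mono)
    show "cbox 0 One \<inter> {u. norm (D u) \<le> \<delta>} \<subseteq> cbox (y - (\<delta> / a) *\<^sub>R One) (y + (\<delta> / a) *\<^sub>R One)"
    proof
      fix u assume "u \<in> cbox 0 One \<inter> {u. norm (D u) \<le> \<delta>}"
      then have "norm (c + a *\<^sub>R u) \<le> \<delta>"
        using D[of u] by simp
      moreover have "c + a *\<^sub>R u = a *\<^sub>R (u - y)"
        using a by (simp add: y_def algebra_simps)
      ultimately have "norm (a *\<^sub>R (u - y)) \<le> \<delta>"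
        by metis
      then have "norm (u - y) \<le> \<delta> / a"
        using a unfolding norm_scaleR by (simp add: pos_le_divide_eq mult.commute)
      then have "\<bar>(u - y) \<bullet> b\<bar> \<le> \<delta> / a" if "b \<in> Basis" for b
        using Basis_le_norm[OF that, of "u - y"] by linarith
      then show "u \<in> cbox (y - (\<delta> / a) *\<^sub>R One) (y + (\<delta> / a) *\<^sub>R One)"
        unfolding mem_box by (fastforce simp: inner_diff_left inner_add_left abs_le_iff)
    qed
  qed simp
  also have "\<dots> = ennreal ((2 * \<delta> / a) ^ DIM('b))"
    using a \<delta> by (simp add: emeasure_lborel_cbox_eq inner_diff_left inner_add_left)
  finally show ?thesis .
qed

lemma emeasure_unit_cube_PiM_affine_le:
  fixes D :: "('i::countable \<Rightarrow> 'b::euclidean_space) \<Rightarrow> 'b"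
  assumes a: "a > 0" and \<delta>: "\<delta> \<ge> 0" and D_cont: "continuous_on UNIV D"
    and D: "\<And>w. \<exists>c. \<forall>u\<in>cbox 0 One. D (w(i := u)) = c + a *\<^sub>R u"
  shows "emeasure unit_cube_PiM {w. norm (D w) \<le> \<delta>} \<le> ennreal ((2 * \<delta> / a) ^ DIM('b))"
proof -
  let ?U = "unit_cube_measure :: 'b measure" and ?P = "unit_cube_PiM :: ('i \<Rightarrow> 'b) measure"
  interpret U: prob_space ?U by (rule prob_space_unit_cube_measure)
  interpret P: prob_space ?P by (rule prob_space_unit_cube_PiM)
  interpret pair_sigma_finite ?U ?P ..
  let ?upd = "\<lambda>(x, X). X(i := x)"
  let ?E = "{w. norm (D w) \<le> \<delta>}"
  have E: "?E \<in> sets ?P"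
    unfolding sets_unit_cube_PiM
    by (intro borel_closed closed_Collect_le continuous_on_norm D_cont continuous_on_const)
  \<comment> \<open>Replacing coordinate \<open>i\<close> by an independent uniform value preserves
    the product measure; this separates that coordinate from the others.\<close>
  have P_distr: "distr (?U \<Otimes>\<^sub>M ?P) ?P ?upd = ?P"
    using distr_pair_PiM_eq_PiM[of UNIV "\<lambda>_. ?U" i] U.prob_space_axioms
    unfolding unit_cube_PiM_def by simp
  have upd: "?upd \<in> measurable (?U \<Otimes>\<^sub>M ?P) ?P"
    unfolding unit_cube_PiM_def case_prod_beta
    by (rule measurable_fun_upd[where J = UNIV]) (auto intro: measurable_fst measurable_snd)
  have upd_P: "(\<lambda>x. X(i := x)) \<in> measurable ?U ?P" for X
    using measurable_compose[OF _ upd, of "\<lambda>x. (x, X)" ?U] by simp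
  have "emeasure ?P ?E = emeasure (?U \<Otimes>\<^sub>M ?P) (?upd -` ?E \<inter> space (?U \<Otimes>\<^sub>M ?P))"
    by (subst P_distr[symmetric], rule emeasure_distr[OF upd E])
  also have "\<dots> = (\<integral>\<^sup>+X. emeasure ?U ((\<lambda>x. (x, X)) -` (?upd -` ?E \<inter> space (?U \<Otimes>\<^sub>M ?P))) \<partial>?P)"
    by (rule emeasure_pair_measure_alt2) (rule measurable_sets[OF upd E])
  also have "\<dots> \<le> (\<integral>\<^sup>+X. ennreal ((2 * \<delta> / a) ^ DIM('b)) \<partial>?P)"
  proof (rule nn_integral_mono)
    fix X
    obtain c where c: "\<And>u. u \<in> cbox 0 One \<Longrightarrow> D (X(i := u)) = c + a *\<^sub>R u"
      using D by blast
    have sU: "space ?U = UNIV"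
      using sets_eq_imp_space_eq[OF sets_unit_cube_measure] by simp
    have eq: "(\<lambda>x. (x, X)) -` (?upd -` ?E \<inter> space (?U \<Otimes>\<^sub>M ?P)) = {u. norm (D (X(i := u))) \<le> \<delta>}"
      by (auto simp: space_pair_measure sU)
    have "{u. norm (D (X(i := u))) \<le> \<delta>} \<in> sets ?U"
      using measurable_sets[OF upd_P E, of X] sU by (simp add: vimage_def)
    then show "emeasure ?U ((\<lambda>x. (x, X)) -` (?upd -` ?E \<inter> space (?U \<Otimes>\<^sub>M ?P))) \<le> ennreal ((2 * \<delta> / a) ^ DIM('b))"
      unfolding eq by (intro emeasure_unit_cube_affine_le[OF a \<delta> _ c]) auto
  qed
  also have "\<dots> = ennreal ((2 * \<delta> / a) ^ DIM('b))"
    using P.emeasure_space_1 by simp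
  finally show ?thesis .
qed

section \<open>Graph packings from few close pairs, and their measurability\<close>

text \<open>Deleting the first member of every close pair removes at most half of the nodes. The
  graph points over the others form a packing, since the product distance dominates both coordinate
  distances.\<close>

lemma card_le_packing_number_graph:
  fixes f :: "'a::metric_space \<Rightarrow> 'b::metric_space" and n :: nat
  defines "\<delta> \<equiv> 2 powr - real n"
  assumes K: "compact (UNIV :: 'a set)" and f: "continuous_on UNIV f"
    and A: "finite A" "inj_on p A"
    and Z: "2 * card {(k, l) \<in> A \<times> A. k \<noteq> l \<and> dist (p k) (p l) \<le> \<delta> \<and> dist (f (p k)) (f (p l)) \<le> \<delta>} \<le> card A"
      (is "2 * card ?Z \<le> _")
  shows "card A \<le> 2 * packing_number n (graph f)"
proof -
  define A' where "A' = A - fst ` ?Z"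
  have Zfin: "finite ?Z"
    by (rule finite_subset[of _ "A \<times> A"]) (use A(1) in auto)
  have "card A - card ?Z \<le> card A'"
    unfolding A'_def using diff_card_le_card_Diff[of "fst ` ?Z" A] card_image_le[OF Zfin, of fst] Zfin
    by simp
  then have "card A \<le> 2 * card A'"
    using Z by linarith
  define h where "h = (\<lambda>k. (p k, f (p k)))"
  have "inj_on h A'"
    using A(2) by (auto simp: inj_on_def h_def A'_def)
  then have "card A' = card (h ` A')"
    by (simp add: card_image)
  also have "\<dots> \<le> packing_number n (graph f)"
  proof (rule packing_card_le_packing_number[OF compact_graph[OF K f]])
    show "h ` A' \<subseteq> graph f" by (auto simp: h_def graph_def)
    show "finite (h ` A')" using A(1) by (simp add: A'_def)
    have "dist (h k) (h l) > \<delta>" if "k \<in> A'" "l \<in> A'" "k \<noteq> l" for k l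
    proof -
      have "(k, l) \<notin> ?Z" using that(1) unfolding A'_def by force
      then have "dist (p k) (p l) > \<delta> \<or> dist (f (p k)) (f (p l)) > \<delta>"
        using that by (auto simp: A'_def)
      moreover have "dist (p k) (p l) \<le> dist (h k) (h l)" "dist (f (p k)) (f (p l)) \<le> dist (h k) (h l)"
        using dist_fst_le[of "h k" "h l"] dist_snd_le[of "h k" "h l"] by (simp_all add: h_def)
      ultimately show ?thesis by linarith
    qed
    then show "packing (2 powr - real n) (h ` A')"
      unfolding packing_def \<delta>_def by auto
  qed
  finally show ?thesis using \<open>card A \<le> 2 * card A'\<close> by linarith
qed

text \<open>Packings are defined by strict inequalities, so one with \<open>m\<close> points
  persists under small perturbations of \<open>f\<close>. The union runs over finite sets of base
  points, which, unlike subsets of the graph, do not vary with \<open>f\<close>.\<close>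

lemma open_packing_number_graph_ge:
  assumes K: "compact (UNIV :: 'a::metric_space set)"
  shows "open {f :: ('a, 'b::metric_space) bcontfun. m \<le> packing_number n (graph (apply_bcontfun f))}"
proof -
  let ?\<delta> = "2 powr - real n"
  let ?G = "\<lambda>T. \<Inter>x\<in>T. \<Inter>y\<in>T - {x}.
      {f :: ('a, 'b) bcontfun. ?\<delta> < dist (x, apply_bcontfun f x) (y, apply_bcontfun f y)}"
  have eval: "continuous_on UNIV (\<lambda>f :: ('a, 'b) bcontfun. apply_bcontfun f x)" for x
    unfolding continuous_on_iff using dist_bounded by (metis order.strict_trans1)
  have "open (?G T)" if "finite T" for T
    using that by (intro open_INT ballI open_Collect_less continuous_intros eval) auto
  then have "open (\<Union>T\<in>{T. finite T \<and> card T = m}. ?G T)"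
    by blast
  also have "(\<Union>T\<in>{T. finite T \<and> card T = m}. ?G T)
      = {f. m \<le> packing_number n (graph (apply_bcontfun f))}"
  proof (intro equalityI subsetI)
    fix f :: "('a, 'b) bcontfun"
    note comp = compact_graph[OF K continuous_on_apply_bcontfun[of UNIV f]]
    let ?h = "\<lambda>x. (x, apply_bcontfun f x)"
    {
      assume "f \<in> (\<Union>T\<in>{T. finite T \<and> card T = m}. ?G T)"
      then obtain T where T: "finite T" "card T = m" "f \<in> ?G T" by blast
      have far: "?\<delta> < dist (?h x) (?h y)" if "x \<in> T" "y \<in> T" "x \<noteq> y" for x y
        using T(3) that by blast
      have "card (?h ` T) \<le> packing_number n (graph (apply_bcontfun f))"
      proof (rule packing_card_le_packing_number[OF comp])
        show "?h ` T \<subseteq> graph (apply_bcontfun f)" "finite (?h ` T)"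
          using T(1) by (auto simp: graph_def)
        show "packing ?\<delta> (?h ` T)"
          unfolding packing_def using far by blast
      qed
      moreover have "card (?h ` T) = card T"
        by (rule card_image) (simp add: inj_on_def)
      ultimately show "f \<in> {f. m \<le> packing_number n (graph (apply_bcontfun f))}"
        using T(2) by simp
    }
    assume "f \<in> {f. m \<le> packing_number n (graph (apply_bcontfun f))}"
    then obtain S where S: "S \<subseteq> graph (apply_bcontfun f)" "finite S" "packing ?\<delta> S" "m \<le> card S"
      using packing_number_attained[OF comp, of n] by (metis mem_Collect_eq)
    then obtain S' where S': "S' \<subseteq> S" "card S' = m" "finite S'"
      by (metis obtain_subset_with_card_n)
    have sub: "S' \<subseteq> graph (apply_bcontfun f)" using S S' by blast
    moreover have "inj_on fst (graph (apply_bcontfun f))"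
      by (auto simp: inj_on_def graph_def)
    ultimately have "inj_on fst S'"
      by (metis inj_on_subset)
    then have "card (fst ` S') = m"
      using S'(2) by (simp add: card_image)
    moreover have h_in: "?h x \<in> S" if "x \<in> fst ` S'" for x
      using that sub S'(1) by (auto simp: graph_def)
    have "?\<delta> < dist (?h x) (?h y)" if "x \<in> fst ` S'" "y \<in> fst ` S' - {x}" for x y
      using S(3)[unfolded packing_def, rule_format, OF h_in[of x] h_in[of y]] that by blast
    then have "f \<in> ?G (fst ` S')"
      by simp
    ultimately show "f \<in> (\<Union>T\<in>{T. finite T \<and> card T = m}. ?G T)"
      using S'(3) by blast
  qed
  finally show ?thesis .
qed

lemma closed_packing_number_graph_small:
  assumes K: "compact (UNIV :: 'a::metric_space set)"
  shows "closed {f :: ('a, 'b::metric_space) bcontfun. 2 * packing_number n (graph (apply_bcontfun f)) < m}"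
proof -
  \<comment> \<open>\<open>(m + 1) div 2\<close> is \<open>m / 2\<close> rounded up.\<close>
  have "{f :: ('a, 'b) bcontfun. 2 * packing_number n (graph (apply_bcontfun f)) < m}
      = - {f. (m + 1) div 2 \<le> packing_number n (graph (apply_bcontfun f))}"
    by auto
  then show ?thesis
    using open_packing_number_graph_ge[OF K, of "(m + 1) div 2" n] by (simp add: closed_open)
qed

section \<open>Probability estimate and Borel-Cantelli\<close>

text \<open>First moment bound: a small packing number forces at least half as many close pairs as
  there are nodes. At most \<open>card (A n) * M\<close> pairs are candidates, each close with
  probability at most \<open>q\<close>, so Markov's inequality gives \<open>2 * M * q\<close>, which
  the condition on \<open>M\<close> bounds by \<open>amp n\<close>.\<close>

lemma emeasure_packing_number_graph_small_le:
  fixes p :: "nat \<Rightarrow> 'k::countable \<Rightarrow> 'a::metric_space" and g :: "('a, 'b::euclidean_space) bcontfun" and n :: nat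
  defines "\<delta> \<equiv> 2 powr - real n"
  assumes K: "compact (UNIV :: 'a set)" and A: "finite (A n)" "inj_on (p n) (A n)"
    and Q: "card {(k, l) \<in> A n \<times> A n. k \<noteq> l \<and> dist (p n k) (p n l) \<le> \<delta>} \<le> card (A n) * M"
    and M: "real M * 2 ^ (DIM('b) + 1) * real (n + 1) ^ (2 * DIM('b) + 2) \<le> 2 ^ (n * DIM('b))"
  shows "emeasure unit_cube_PiM
      {w. 2 * packing_number n (graph (apply_bcontfun (g + random_fun A p w))) < card (A n)} \<le> ennreal (amp n)"
    (is "emeasure ?P ?E \<le> _")
proof -
  let ?F = "\<lambda>w. apply_bcontfun (g + random_fun A p w)"
  let ?Q = "{(k, l) \<in> A n \<times> A n. k \<noteq> l \<and> dist (p n k) (p n l) \<le> \<delta>}"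
  \<comment> \<open>For a pair in \<open>?Q\<close> the nodes are already close in the domain;
    \<open>C\<close> is the event that the values are close as well.\<close>
  define C where "C = (\<lambda>(k, l). {w. norm (?F w (p n k) - ?F w (p n l)) \<le> \<delta>})"
  define q where "q = (2 * \<delta> / amp n) ^ DIM('b)"
  have \<delta>: "\<delta> \<ge> 0" by (simp add: \<delta>_def)
  have q: "q \<ge> 0" unfolding q_def using \<delta> amp_pos[of n] by simp
  have Qfin: "finite ?Q"
    by (rule finite_subset[of _ "A n \<times> A n"]) (use A(1) in auto)
  have Fcont: "continuous_on UNIV (\<lambda>w. g + random_fun A p w)"
    by (intro continuous_on_add continuous_on_const continuous_on_random_fun K)
  have Fx: "continuous_on UNIV (\<lambda>w. ?F w x)" for x
    by (rule bounded_linear.continuous_on[OF bounded_linear_apply_bcontfun Fcont])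
  have C_sets: "C kl \<in> sets ?P" for kl
    unfolding C_def sets_unit_cube_PiM case_prod_beta
    by (intro borel_closed closed_Collect_le continuous_on_norm continuous_on_diff Fx continuous_on_const)
  have "?E = (\<lambda>w. g + random_fun A p w) -` {f. 2 * packing_number n (graph (apply_bcontfun f)) < card (A n)}"
    by auto
  then have "closed ?E"
    using closed_vimage[OF closed_packing_number_graph_small[OF K] Fcont] by simp
  then have E_sets: "?E \<in> sets ?P"
    by (simp only: sets_unit_cube_PiM borel_closed)
  have C_le: "emeasure ?P (C kl) \<le> ennreal q" if kl_in: "kl \<in> ?Q" for kl
  proof -
    obtain k l where kl: "kl = (k, l)" "k \<in> A n" "l \<in> A n" "k \<noteq> l"
      using kl_in by auto
    show ?thesis
      unfolding q_def C_def kl(1) prod.case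
      by (rule emeasure_unit_cube_PiM_affine_le[where i = "(n, k)" and D = "\<lambda>w. ?F w (p n k) - ?F w (p n l)",
            OF amp_pos \<delta> continuous_on_diff[OF Fx Fx]])
         (rule random_fun_increment[where A = A and p = p and n = n, OF A kl(2-4)])
  qed
  \<comment> \<open>Contrapositive of \<open>card_le_packing_number_graph\<close>, with the close
    pairs counted by indicators.\<close>
  have E_count: "real (card (A n)) \<le> (\<Sum>kl\<in>?Q. 2 * indicator (C kl) w)" if "w \<in> ?E" for w
  proof (rule ccontr)
    assume "\<not> ?thesis"
    then have less: "2 * (\<Sum>kl\<in>?Q. indicator (C kl) w) < real (card (A n))"
      by (simp add: sum_distrib_left)
    have "(\<Sum>kl\<in>?Q. indicator (C kl) w) = real (card {kl \<in> ?Q. w \<in> C kl})"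
      using Qfin by (simp add: indicator_def sum.If_cases Int_def)
    also have "{kl \<in> ?Q. w \<in> C kl} = {(k, l) \<in> A n \<times> A n. k \<noteq> l \<and> dist (p n k) (p n l) \<le> 2 powr - real n
        \<and> dist (?F w (p n k)) (?F w (p n l)) \<le> 2 powr - real n}"
      by (auto simp: C_def \<delta>_def dist_norm)
    finally have "card (A n) \<le> 2 * packing_number n (graph (?F w))"
      using less by (intro card_le_packing_number_graph[OF K continuous_on_apply_bcontfun A]) linarith
    then show False using that by simp
  qed
  show ?thesis
  \<comment> \<open>Markov's inequality below ends by cancelling \<open>card (A n)\<close>; if this
    is 0, the event is empty.\<close>
  proof (cases "card (A n) = 0")
    case True
    then show ?thesis by simp
  next
    case False
    have "ennreal (card (A n)) * emeasure ?P ?E = (\<integral>\<^sup>+w. ennreal (card (A n)) * indicator ?E w \<partial>?P)"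
      using E_sets by (simp add: nn_integral_cmult_indicator)
    also have "\<dots> \<le> (\<integral>\<^sup>+w. (\<Sum>kl\<in>?Q. 2 * indicator (C kl) w) \<partial>?P)"
    proof (rule nn_integral_mono)
      fix w :: "nat \<times> 'k \<Rightarrow> 'b"
      have "(\<Sum>kl\<in>?Q. 2 * indicator (C kl) w) = ennreal (\<Sum>kl\<in>?Q. 2 * indicator (C kl) w)"
        by (subst sum_ennreal[symmetric]) (auto simp: ennreal_mult ennreal_indicator)
      then show "ennreal (card (A n)) * indicator ?E w \<le> (\<Sum>kl\<in>?Q. 2 * indicator (C kl) w)"
        using E_count[of w] by (simp add: indicator_def ennreal_leI del: sum_ennreal)
    qed
    also have "\<dots> = (\<Sum>kl\<in>?Q. 2 * emeasure ?P (C kl))"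
      using C_sets by (subst nn_integral_sum) (simp_all add: nn_integral_cmult_indicator)
    also have "\<dots> \<le> (\<Sum>kl\<in>?Q. ennreal (2 * q))"
      using C_le q by (intro sum_mono) (simp add: ennreal_mult mult_left_mono)
    also have "\<dots> = ennreal (real (card ?Q) * (2 * q))"
      using q by (simp add: ennreal_mult ennreal_of_nat_eq_real_of_nat)
    also have "\<dots> \<le> ennreal (real (card (A n) * M) * (2 * q))"
      using Q q by (intro ennreal_leI mult_right_mono) (simp_all only: of_nat_le_iff)
    also have "\<dots> = ennreal (card (A n)) * ennreal (2 * real M * q)"
      using q by (simp add: ennreal_mult[symmetric] ac_simps)
    finally have "emeasure ?P ?E \<le> ennreal (2 * real M * q)"
      using False by (subst (asm) ennreal_mult_le_mult_iff) auto
    also have "2 * real M * q \<le> amp n"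
    proof -
      have "q = 2 ^ DIM('b) * real (n + 1) ^ (2 * DIM('b)) / 2 ^ (n * DIM('b))"
        unfolding q_def \<delta>_def amp_def
        by (simp add: powr_minus powr_realpow power_mult_distrib power_divide power_mult[symmetric] field_simps)
      then have "2 * real M * q * real (n + 1) ^ 2
          = real M * 2 ^ (DIM('b) + 1) * real (n + 1) ^ (2 * DIM('b) + 2) / 2 ^ (n * DIM('b))"
        by (simp add: power_add power2_eq_square)
      also have "\<dots> \<le> 1"
        using M by simp
      finally show ?thesis
        by (simp add: amp_def field_simps)
    qed
    finally show ?thesis by (simp add: ennreal_leI)
  qed
qed

text \<open>The law of the random series witnesses that \<open>limsup B\<close> is shy, the set of
  functions whose graph packings are too small at infinitely many scales. It is Borel since each
  \<open>B n\<close> is closed, and the bound \<open>amp n\<close> holds for every shift, so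
  Borel-Cantelli applies to each translate.\<close>

lemma prevalently_packing_number_graph:
  fixes p :: "nat \<Rightarrow> 'k::countable \<Rightarrow> 'a::metric_space"
  assumes K: "compact (UNIV :: 'a set)"
    and A: "\<And>n. finite (A n)" "\<And>n. inj_on (p n) (A n)"
    and Q: "\<And>n. card {(k, l) \<in> A n \<times> A n. k \<noteq> l \<and> dist (p n k) (p n l) \<le> 2 powr - real n}
                 \<le> card (A n) * M n"
    and M: "\<And>n. real (M n) * 2 ^ (DIM('b) + 1) * real (n + 1) ^ (2 * DIM('b) + 2) \<le> 2 ^ (n * DIM('b))"
  shows "prevalently (\<lambda>f :: ('a, 'b::euclidean_space) bcontfun.
      eventually (\<lambda>n. card (A n) \<le> 2 * packing_number n (graph (apply_bcontfun f))) sequentially)"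
proof -
  let ?P = "unit_cube_PiM :: (nat \<times> 'k \<Rightarrow> 'b) measure"
  interpret P: prob_space ?P by (rule prob_space_unit_cube_PiM)
  define F :: "(nat \<times> 'k \<Rightarrow> 'b) \<Rightarrow> ('a, 'b) bcontfun" where "F = random_fun A p"
  define \<mu> where "\<mu> = distr ?P borel F"
  define B where "B = (\<lambda>n. {f :: ('a, 'b) bcontfun. 2 * packing_number n (graph (apply_bcontfun f)) < card (A n)})"
  have F_cont: "continuous_on UNIV F"
    unfolding F_def by (rule continuous_on_random_fun[OF K])
  have F_meas: "F \<in> borel_measurable ?P"
    by (subst measurable_cong_sets[OF sets_unit_cube_PiM refl]) (rule borel_measurable_continuous_onI[OF F_cont])
  have B_sets: "B n \<in> sets borel" for n
    unfolding B_def by (rule borel_closed[OF closed_packing_number_graph_small[OF K]])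
  then have limsup_sets: "limsup B \<in> sets borel"
    by (rule measurable_limsup)
  have null: "emeasure \<mu> ((\<lambda>b. b + x) ` limsup B) = 0" for x
  proof -
    define E where "E = (\<lambda>n. {w. - x + F w \<in> B n})"
    \<comment> \<open>As a preimage, the translate has measure equal to the probability that
      \<open>- x + F\<close> lies in \<open>limsup B\<close>, so the estimate is applied with
      \<open>g = - x\<close>.\<close>
    have shift: "(\<lambda>b. b + x) ` limsup B = (\<lambda>f. - x + f) -` limsup B"
      by (auto simp: image_iff) (metis add.commute diff_add_cancel uminus_add_conv_diff)
    have shift_cont: "continuous_on UNIV (\<lambda>f. - x + f)"
      by (intro continuous_intros)
    have shift_sets: "(\<lambda>f. - x + f) -` limsup B \<in> sets borel"
      using measurable_sets[OF borel_measurable_continuous_onI[OF shift_cont] limsup_sets] by simp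
    have xF_meas: "(\<lambda>w. - x + F w) \<in> borel_measurable ?P"
      using measurable_compose[OF F_meas borel_measurable_continuous_onI[OF shift_cont]] .
    have E_sets: "E n \<in> sets ?P" for n
      using measurable_sets[OF xF_meas B_sets[of n]] by (simp add: E_def vimage_def)
    have E_le: "emeasure ?P (E n) \<le> ennreal (amp n)" for n
      unfolding E_def B_def F_def mem_Collect_eq
      by (rule emeasure_packing_number_graph_small_le[where A = A and p = p and n = n and M = "M n", OF K A Q M])
    have "measure ?P (E n) \<le> amp n" for n
      using E_le[of n] amp_pos[of n] by (simp add: P.emeasure_eq_measure)
    then have "summable (\<lambda>n. measure ?P (E n))"
      by (intro summable_comparison_test'[OF summable_amp, where N = 0]) simp
    then have "limsup E \<in> null_sets ?P"
      by (intro borel_cantelli_limsup1 E_sets) (simp_all add: P.emeasure_eq_measure)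
    moreover have "limsup E = F -` (\<lambda>f. - x + f) -` limsup B"
      by (auto simp: limsup_INF_SUP E_def)
    ultimately show ?thesis
      unfolding \<mu>_def shift emeasure_distr[OF F_meas shift_sets] space_unit_cube_PiM Int_UNIV_right
      by (simp only: null_setsD1)
  qed
  have "prob_space \<mu>" "sets \<mu> = sets borel"
    unfolding \<mu>_def by (simp_all add: P.prob_space_distr[OF F_meas])
  then have "prevalent (- limsup B)"
    unfolding prevalent_def shy_def double_compl using limsup_sets null by blast
  moreover have "- limsup B \<subseteq> {f. eventually (\<lambda>n. card (A n) \<le> 2 * packing_number n (graph (apply_bcontfun f))) sequentially}"
    by (auto simp: mem_limsup_iff not_frequently B_def not_less)
  ultimately show ?thesis
    unfolding prevalently_def by blast
qed

section \<open>Clusters of nodes around a packing\<close>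

text \<open>Each point of \<open>S\<close>, being a limit point, is replaced by \<open>M\<close>
  points of a tiny ball around it. Different clusters stay more than \<open>\<delta>\<close> apart,
  so all points near a given one lie in its own cluster.\<close>

lemma finite_set_in_clusters:
  fixes S :: "'a::metric_space set"
  assumes S: "finite S" "\<And>s. s \<in> S \<Longrightarrow> s islimpt UNIV" "packing \<delta> S" and \<delta>: "\<delta> \<ge> 0"
  obtains X :: "'a set" where "finite X" "card X = card S * M"
    "\<And>x. x \<in> X \<Longrightarrow> card {y \<in> X. dist x y \<le> \<delta>} \<le> M"
proof -
  \<comment> \<open>The finitely many gaps are positive because packings are strict; inserting 1
    keeps \<open>Min D\<close> meaningful when \<open>S\<close> has fewer than two points.\<close>
  define D where "D = insert 1 ((\<lambda>(s, t). dist s t - \<delta>) ` {(s, t) \<in> S \<times> S. s \<noteq> t})"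
  have "finite {(s, t) \<in> S \<times> S. s \<noteq> t}"
    by (rule finite_subset[of _ "S \<times> S"]) (use S(1) in auto)
  then have D: "finite D" "D \<noteq> {}"
    by (simp_all add: D_def)
  have "d > 0" if "d \<in> D" for d
    using that S(3) by (auto simp: D_def packing_def)
  then have "Min D > 0"
    using D by simp
  \<comment> \<open>Moving both centres by less than \<open>\<epsilon>\<close> shortens their
    distance by less than the least gap.\<close>
  define \<epsilon> where "\<epsilon> = Min D / 2"
  have \<epsilon>: "\<epsilon> > 0" using \<open>Min D > 0\<close> by (simp add: \<epsilon>_def)
  have gap: "dist s t \<ge> \<delta> + 2 * \<epsilon>" if "s \<in> S" "t \<in> S" "s \<noteq> t" for s t
  proof -
    have "dist s t - \<delta> \<in> D" using that by (force simp: D_def)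
    then have "Min D \<le> dist s t - \<delta>" using D(1) by simp
    then show ?thesis by (simp add: \<epsilon>_def)
  qed
  have "\<exists>C. finite C \<and> card C = M \<and> C \<subseteq> ball s \<epsilon>" if "s \<in> S" for s
  proof -
    have "infinite (ball s \<epsilon>)"
      using S(2)[OF that] \<epsilon> by (simp add: islimpt_eq_infinite_ball)
    then show ?thesis using infinite_arbitrarily_large by blast
  qed
  then obtain C where C: "\<And>s. s \<in> S \<Longrightarrow> finite (C s) \<and> card (C s) = M \<and> C s \<subseteq> ball s \<epsilon>"
    by metis
  have far: "dist x y > \<delta>" if "s \<in> S" "t \<in> S" "s \<noteq> t" "x \<in> C s" "y \<in> C t" for s t x y
  proof -
    have "dist s x < \<epsilon>" "dist t y < \<epsilon>"
      using that C by (auto simp: subset_iff)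
    moreover have "dist s t \<le> dist s x + dist x y + dist t y"
      using dist_triangle[of s t x] dist_triangle[of x t y] by (simp add: dist_commute)
    ultimately show ?thesis using gap[OF that(1-3)] by linarith
  qed
  define X where "X = (\<Union>s\<in>S. C s)"
  have X_fin: "finite X" using S(1) C by (simp add: X_def)
  have X_card: "card X = card S * M"
  proof -
    have "C s \<inter> C t = {}" if "s \<in> S" "t \<in> S" "s \<noteq> t" for s t
      using far[OF that] \<delta> by fastforce
    then have "card X = (\<Sum>s\<in>S. card (C s))"
      unfolding X_def using S(1) C by (intro card_UN_disjoint) auto
    then show ?thesis using C by simp
  qed
  have "card {y \<in> X. dist x y \<le> \<delta>} \<le> M" if "x \<in> X" for x
  proof -
    obtain s where s: "s \<in> S" "x \<in> C s" using \<open>x \<in> X\<close> by (auto simp: X_def)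
    have "{y \<in> X. dist x y \<le> \<delta>} \<subseteq> C s"
    proof
      fix y assume "y \<in> {y \<in> X. dist x y \<le> \<delta>}"
      then obtain t where "t \<in> S" "y \<in> C t" "dist x y \<le> \<delta>" by (auto simp: X_def)
      then show "y \<in> C s" using far[OF s(1) _ _ s(2), of t y] by (cases "s = t") auto
    qed
    then show ?thesis using C[OF s(1)] card_mono by metis
  qed
  then show thesis by (rule that[OF X_fin X_card])
qed

text \<open>Dropping from a maximal packing its points in \<open>I\<close> loses at most
  \<open>card I\<close> of them. The constant factor \<open>card I + 1\<close> disappears in the
  dimension.\<close>

lemma limit_point_packing:
  fixes I :: "'a::metric_space set"
  assumes K: "compact (UNIV :: 'a set)" "infinite (UNIV :: 'a set)"
    and I: "finite I" "\<And>s. s \<notin> I \<Longrightarrow> s islimpt UNIV"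
  obtains S :: "'a set" where "finite S" "\<And>s. s \<in> S \<Longrightarrow> s islimpt UNIV" "packing (2 powr - real n) S"
    "packing_number n (UNIV :: 'a set) \<le> card S * (card I + 1)"
proof -
  obtain T :: "'a set" where T: "finite T" "packing (2 powr - real n) T"
      "card T = packing_number n (UNIV :: 'a set)"
    using packing_number_attained[OF K(1)] by blast
  have T_card: "card T \<le> card (T - I) + card I"
    using diff_card_le_card_Diff[OF I(1), of T] by linarith
  show thesis
  proof (cases "T - I = {}")
    case True
    \<comment> \<open>A packing inside \<open>I\<close> has at most \<open>card I\<close> points, so
      a single limit point suffices.\<close>
    obtain x where "x \<notin> I" using K(2) I(1) by (metis ex_new_if_finite)
    then show thesis
      using I(2) T_card T(3) True by (intro that[of "{x}"]) (auto simp: packing_def)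
  next
    case False
    then have "card (T - I) \<ge> 1"
      using T(1) by (simp add: Suc_le_eq card_gt_0_iff)
    then have "card I \<le> card (T - I) * card I" by (cases "card (T - I)") auto
    then have "packing_number n (UNIV :: 'a set) \<le> card (T - I) * (card I + 1)"
      using T_card T(3) unfolding distrib_left by linarith
    then show thesis
      using I(2) T by (intro that[of "T - I"]) (auto simp: packing_def)
  qed
qed

text \<open>Enumerating the clustered points by \<open>{..<m}\<close> gives the nodes of all levels
  one countable index type. Ordered close pairs are counted by summing over \<open>k\<close>, as at
  most \<open>M\<close> nodes, itself included, are near each node.\<close>

lemma clustered_points:
  fixes I :: "'a::metric_space set"
  assumes K: "compact (UNIV :: 'a set)" "infinite (UNIV :: 'a set)"
    and I: "finite I" "\<And>s. s \<notin> I \<Longrightarrow> s islimpt UNIV"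
  shows "\<exists>m (p :: nat \<Rightarrow> 'a). inj_on p {..<m} \<and>
    card {(k, l) \<in> {..<m} \<times> {..<m}. k \<noteq> l \<and> dist (p k) (p l) \<le> 2 powr - real n} \<le> m * M \<and>
    packing_number n (UNIV :: 'a set) * M \<le> m * (card I + 1)"
proof -
  let ?\<delta> = "2 powr - real n"
  obtain S :: "'a set" where S: "finite S" "\<And>s. s \<in> S \<Longrightarrow> s islimpt UNIV" "packing ?\<delta> S"
    "packing_number n (UNIV :: 'a set) \<le> card S * (card I + 1)"
    using limit_point_packing[OF K I] by blast
  obtain X :: "'a set" where X: "finite X" "card X = card S * M"
    "\<And>x. x \<in> X \<Longrightarrow> card {y \<in> X. dist x y \<le> ?\<delta>} \<le> M"
    using finite_set_in_clusters[OF S(1-3), of M] by auto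
  obtain p where p: "bij_betw p {..<card X} X"
    using ex_bij_betw_nat_finite[OF X(1)] by (auto simp: atLeast0LessThan)
  let ?m = "card X"
  let ?near = "\<lambda>k. {l \<in> {..<?m}. dist (p k) (p l) \<le> ?\<delta>}"
  have near: "card (?near k) \<le> M" if "k < ?m" for k
  proof -
    have pk: "p k \<in> X" using p that by (auto simp: bij_betw_def)
    have "card (?near k) = card (p ` ?near k)"
      using p by (intro card_image[symmetric]) (auto simp: bij_betw_def inj_on_def)
    also have "\<dots> \<le> card {y \<in> X. dist (p k) y \<le> ?\<delta>}"
      using p X(1) by (intro card_mono) (auto simp: bij_betw_def)
    also have "\<dots> \<le> M" by (rule X(3)[OF pk])
    finally show ?thesis .
  qed
  have "card {(k, l) \<in> {..<?m} \<times> {..<?m}. k \<noteq> l \<and> dist (p k) (p l) \<le> ?\<delta>} \<le> card (SIGMA k:{..<?m}. ?near k)"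
    by (rule card_mono) (auto intro!: finite_SigmaI)
  also have "\<dots> = (\<Sum>k<?m. card (?near k))"
    by (rule card_SigmaI) auto
  also have "\<dots> \<le> (\<Sum>k<?m. M)"
    using near by (intro sum_mono) simp
  finally have "card {(k, l) \<in> {..<?m} \<times> {..<?m}. k \<noteq> l \<and> dist (p k) (p l) \<le> ?\<delta>} \<le> ?m * M"
    by simp
  moreover have "packing_number n (UNIV :: 'a set) * M \<le> ?m * (card I + 1)"
    using mult_right_mono[OF S(4), of M] X(2) by (simp add: ac_simps)
  ultimately show ?thesis
    using p by (auto simp: bij_betw_def)
qed

section \<open>Cluster sizes and the dimension formulas\<close>

text \<open>The bound already holds with \<open>2 ^ n\<close> in the numerator, and
  \<open>d > 0\<close> gives \<open>2 ^ n \<le> 2 ^ (n * d)\<close>. With \<open>a = 2\<close> it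
  ensures that rounding down the cluster size costs at most a factor 2.\<close>

lemma eventually_exp_div_power_ge:
  assumes "d > 0" "c > 0"
  shows "eventually (\<lambda>n. a \<le> 2 ^ (n * d) / (c * real (n + 1) ^ k)) sequentially"
proof -
  have "filterlim (\<lambda>n. 2 ^ n / (c * real (n + 1) ^ k)) at_top sequentially"
    using \<open>c > 0\<close> by real_asymp
  then have "eventually (\<lambda>n. a \<le> 2 ^ n / (c * real (n + 1) ^ k)) sequentially"
    by (simp add: filterlim_at_top)
  then show ?thesis
  proof eventually_elim
    case (elim n)
    have "(2::real) ^ n \<le> 2 ^ (n * d)"
      using assms(1) by (intro power_increasing) auto
    then show ?case
      using elim assms(2) by (smt (verit) divide_right_mono mult_nonneg_nonneg of_nat_0_le_iff zero_le_power)
  qed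
qed

text \<open>The space \<open>K\<close> is the universe of \<open>'a\<close>; as it is compact,
  \<open>bcontfun\<close> with its supremum norm contains all continuous maps into
  \<open>real ^ 'd\<close>.\<close>

theorem theorem1p8:
  assumes "compact (UNIV :: 'a::metric_space set)"
    and "uncountable (UNIV :: 'a set)"
    and "finite {x :: 'a. x isolated_in UNIV}"
  shows "prevalently (\<lambda>f :: ('a, real ^ 'd) bcontfun.
           lower_box_dim (graph (apply_bcontfun f)) = lower_box_dim (UNIV :: 'a set) + ereal (real CARD('d)) \<and>
           upper_box_dim (graph (apply_bcontfun f)) = upper_box_dim (UNIV :: 'a set) + ereal (real CARD('d)))"
proof -
  define d where "d = CARD('d)"
  have d: "DIM(real ^ 'd) = d" "d > 0" by (simp_all add: d_def)
  define i where "i = card {x :: 'a. x isolated_in UNIV}"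
  \<comment> \<open>The factor that multiplies the cluster size in the last hypothesis of
    \<open>prevalently_packing_number_graph\<close>.\<close>
  define r :: "nat \<Rightarrow> nat" where "r = (\<lambda>n. 2 ^ (d + 1) * (n + 1) ^ (2 * d + 2))"
  \<comment> \<open>The largest cluster size allowed by that hypothesis. It is 0 for small
    \<open>n\<close>, which does not affect the eventual bounds.\<close>
  define M where "M = (\<lambda>n. 2 ^ (n * d) div r n)"
  have "infinite (UNIV :: 'a set)"
    using assms(2) countable_finite by blast
  moreover have "s islimpt UNIV" if "s \<notin> {x :: 'a. x isolated_in UNIV}" for s
    using that by (simp add: isolated_in_islimpt_iff)
  ultimately have "\<forall>n. \<exists>m (p :: nat \<Rightarrow> 'a). inj_on p {..<m} \<and>
      card {(k, l) \<in> {..<m} \<times> {..<m}. k \<noteq> l \<and> dist (p k) (p l) \<le> 2 powr - real n} \<le> m * M n \<and>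
      packing_number n (UNIV :: 'a set) * M n \<le> m * (i + 1)"
    unfolding i_def by (intro allI clustered_points assms(1,3)) auto
  then obtain m p where mp: "\<forall>n. inj_on (p n :: nat \<Rightarrow> 'a) {..<m n} \<and>
      card {(k, l) \<in> {..<m n} \<times> {..<m n}. k \<noteq> l \<and> dist (p n k) (p n l) \<le> 2 powr - real n} \<le> m n * M n \<and>
      packing_number n (UNIV :: 'a set) * M n \<le> m n * (i + 1)"
    unfolding choice_iff by blast
  have r: "real (r n) = 2 ^ (d + 1) * real (n + 1) ^ (2 * d + 2)" for n
    by (simp only: r_def of_nat_mult of_nat_power of_nat_numeral)
  have "M n * r n \<le> 2 ^ (n * d)" for n
    by (simp add: M_def)
  then have "real (M n * r n) \<le> 2 ^ (n * d)" for n
    by (metis of_nat_le_iff of_nat_numeral of_nat_power)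
  then have M_le: "real (M n) * 2 ^ (DIM(real ^ 'd) + 1) * real (n + 1) ^ (2 * DIM(real ^ 'd) + 2)
      \<le> 2 ^ (n * DIM(real ^ 'd))" for n
    unfolding d(1) by (simp only: of_nat_mult r mult.assoc)
  obtain \<S> :: "('a, real ^ 'd) bcontfun set" where \<S>: "prevalent \<S>"
    "\<And>f. f \<in> \<S> \<Longrightarrow> eventually (\<lambda>n. card {..<m n} \<le> 2 * packing_number n (graph (apply_bcontfun f))) sequentially"
    using prevalently_packing_number_graph[where A = "\<lambda>n. {..<m n}" and p = p and M = M and 'b = "real ^ 'd",
        OF assms(1) finite_lessThan _ _ M_le] mp
    unfolding prevalently_def by auto
  \<comment> \<open>Collects \<open>2 ^ (d + 1)\<close> from \<open>r\<close>, a factor 2 for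
    rounding, a factor 2 for discarded nodes and \<open>i + 1\<close> for isolated points.\<close>
  define c where "c = 1 / (2 ^ (d + 3) * (real i + 1))"
  have c: "c > 0" by (simp add: c_def)
  have "lower_box_dim (graph (apply_bcontfun f)) = lower_box_dim (UNIV :: 'a set) + ereal (real d) \<and>
      upper_box_dim (graph (apply_bcontfun f)) = upper_box_dim (UNIV :: 'a set) + ereal (real d)"
    if "f \<in> \<S>" for f
  proof -
    have "graph (apply_bcontfun f) \<noteq> {}" by (simp add: graph_def)
    note compacts = assms(1) UNIV_not_empty compact_graph[OF assms(1) continuous_on_apply_bcontfun[of UNIV f]] this
    obtain C where C: "C > 0" "\<And>n. real (packing_number n (graph (apply_bcontfun f)))
           \<le> real (packing_number (n + 2) (UNIV :: 'a set)) * (C * 2 ^ n) ^ d"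
      using packing_number_graph_le[OF assms(1) continuous_on_apply_bcontfun[of UNIV f]] unfolding d(1) by blast
    have "eventually (\<lambda>n. (2::real) \<le> 2 ^ (n * d) / (2 ^ (d + 1) * real (n + 1) ^ (2 * d + 2))) sequentially"
      using d(2) by (intro eventually_exp_div_power_ge) auto
    with \<S>(2)[OF that] have "eventually (\<lambda>n. c * real (packing_number n (UNIV :: 'a set)) * 2 ^ (n * d) / real (n + 1) ^ (2 * d + 2)
        \<le> real (packing_number n (graph (apply_bcontfun f)))) sequentially"
    proof eventually_elim
      case (elim n)
      let ?N = "real (packing_number n (UNIV :: 'a set))"
      \<comment> \<open>\<open>M n\<close> is \<open>q\<close> rounded down, so
        \<open>q \<ge> 2\<close> will give \<open>q \<le> 2 * M n\<close>.\<close>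
      define q where "q = (2::real) ^ (n * d) / real (r n)"
      have "q \<ge> 2" using elim(2) by (simp only: q_def r)
      moreover have "q < real (M n) + 1"
      proof -
        have "r n > 0" by (simp add: r_def)
        then have "2 ^ (n * d) < (M n + 1) * r n"
          using dividend_less_div_times[of "r n" "2 ^ (n * d)"] by (simp add: M_def)
        then have "real (2 ^ (n * d)) < real ((M n + 1) * r n)"
          by (simp only: of_nat_less_iff)
        then show ?thesis
          using \<open>r n > 0\<close> by (simp add: q_def pos_divide_less_eq distrib_right add.commute)
      qed
      ultimately have "q \<le> 2 * real (M n)" by linarith
      then have "?N * q \<le> 2 * (?N * real (M n))"
        using mult_left_mono[of q "2 * real (M n)" ?N] by (simp add: mult.left_commute)
      also have "\<dots> \<le> 2 * (real (m n) * (real i + 1))"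
      proof -
        have "real (packing_number n (UNIV :: 'a set) * M n) \<le> real (m n * (i + 1))"
          unfolding of_nat_le_iff using mp by blast
        then show ?thesis by (simp add: distrib_left add.commute)
      qed
      also have "\<dots> \<le> 4 * (real i + 1) * real (packing_number n (graph (apply_bcontfun f)))"
      proof -
        have "real (m n) \<le> 2 * real (packing_number n (graph (apply_bcontfun f)))"
          using elim(1) by simp
        then show ?thesis
          using mult_right_mono[of "real (m n)" _ "real i + 1"] by (fastforce simp: algebra_simps)
      qed
      finally have "?N * q / (4 * (real i + 1)) \<le> real (packing_number n (graph (apply_bcontfun f)))"
        by (simp add: divide_le_eq ac_simps)
      moreover have "c * ?N * 2 ^ (n * d) / real (n + 1) ^ (2 * d + 2) = ?N * q / (4 * (real i + 1))"
        unfolding q_def r by (simp add: c_def power_add field_simps)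
      ultimately show ?case by simp
    qed
    then show ?thesis
      using box_dim_eq_add[OF compacts C c] by blast
  qed
  with \<S>(1) show ?thesis
    unfolding prevalently_def d_def by blast
qed

end
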